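(* Let $G$ be a finite group. Then the following are equivalent: (i) $\mathcal{P}(G)=\mathcal{P}^o(G)$; (ii) $\mathcal{P}_e(G)=\mathcal{P}_e^o(G)$; (iii) $G$ is cyclic.
   Context: All graphs are simple and undirected with vertex set $G$; equality of two such graphs means they have the same edge set. The power graph $\mathcal{P}(G)$: two distinct elements are adjacent iff one of them is a positive integral power of the other. The enhanced power graph $\mathcal{P}_e(G)$: two distinct elements are adjacent iff both are contained in a common cyclic subgroup of $G$. Let $o(g)$ denote the order of $g\in G$. For $A\in\{\mathcal{P},\mathcal{P}_e\}$, the order super $A$ graph $A^o(G)$ is the graph on $G$ in which two distinct elements $g,h$ are adjacent iff either $o(g)=o(h)$, or there exist $g',h'\in G$ with $o(g')=o(g)$, $o(h')=o(h)$ such that $g'$ and $h'$ are adjacent in $A(G)$. *)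

theory Defs
  imports "HOL-Algebra.Algebra" "Graph_Theory.Pair_Digraph"
begin

text \<open>
  A simple undirected graph is represented as a symmetric loop-free pair digraph
  (the locale \<^locale>\<open>pair_graph\<close> when the vertex set is finite): an edge between \<open>x\<close> and \<open>y\<close> is the
  pair of arcs \<open>(x, y)\<close>, \<open>(y, x)\<close>. Equality of such records is equality of the vertex sets and of
  the edge sets. The lemmas at the end show that all the graphs below are of this kind.
\<close>

definition power_graph :: "('a, 'b) monoid_scheme \<Rightarrow> 'a pair_pre_digraph" where
  "power_graph G =
     \<lparr>pverts = carrier G,
      parcs = {(x, y). x \<in> carrier G \<and> y \<in> carrier G \<and> x \<noteq> y \<and>
                 (\<exists>n::nat. n > 0 \<and> (y = x [^]\<^bsub>G\<^esub> n \<or> x = y [^]\<^bsub>G\<^esub> n))}\<rparr>"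

definition enhanced_power_graph :: "('a, 'b) monoid_scheme \<Rightarrow> 'a pair_pre_digraph" where
  "enhanced_power_graph G =
     \<lparr>pverts = carrier G,
      parcs = {(x, y). x \<in> carrier G \<and> y \<in> carrier G \<and> x \<noteq> y \<and>
                 (\<exists>C. subgroup C G \<and> cyclic_group (G\<lparr>carrier := C\<rparr>) \<and> x \<in> C \<and> y \<in> C)}\<rparr>"

definition order_super_graph ::
  "('a, 'b) monoid_scheme \<Rightarrow> 'a pair_pre_digraph \<Rightarrow> 'a pair_pre_digraph" where
  "order_super_graph G A =
     \<lparr>pverts = carrier G,
      parcs = {(g, h). g \<in> carrier G \<and> h \<in> carrier G \<and> g \<noteq> h \<and>
                 (group.ord G g = group.ord G h \<or>
                  (\<exists>g' \<in> carrier G. \<exists>h' \<in> carrier G.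
                     group.ord G g' = group.ord G g \<and> group.ord G h' = group.ord G h \<and>
                     (g', h') \<in> parcs A))}\<rparr>"

lemma pair_graphI:
  assumes "finite (pverts H)"
    and "\<And>x y. (x, y) \<in> parcs H \<Longrightarrow> x \<in> pverts H \<and> y \<in> pverts H \<and> x \<noteq> y \<and> (y, x) \<in> parcs H"
  shows "pair_graph H"
proof -
  have "parcs H \<subseteq> pverts H \<times> pverts H"
    using assms(2) by auto
  then have "finite (parcs H)"
    using assms(1) by (meson finite_SigmaI finite_subset)
  then show ?thesis
    using assms
    by unfold_locales (auto simp: symmetric_def sym_def)
qed

lemma pair_graph_power_graph:
  "finite (carrier G) \<Longrightarrow> pair_graph (power_graph G)"
  by (rule pair_graphI) (auto simp: power_graph_def)

lemma pair_graph_enhanced_power_graph: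
  "finite (carrier G) \<Longrightarrow> pair_graph (enhanced_power_graph G)"
  by (rule pair_graphI) (auto simp: enhanced_power_graph_def)

lemma pair_graph_order_super_graph:
  assumes "finite (carrier G)" and "pair_graph A"
  shows "pair_graph (order_super_graph G A)"
proof -
  have "(h, g) \<in> parcs A" if "(g, h) \<in> parcs A" for g h
  proof -
    interpret pair_graph A by fact
    show ?thesis using that by (rule arcs_symmetric)
  qed
  then show ?thesis
    using assms(1) by (intro pair_graphI) (auto simp: order_super_graph_def)
qed

end

theory Submission
  imports Defs "HOL-Number_Theory.Cong"
begin

text \<open>
  In a finite cyclic group, \<open>y\<close> is a power of \<open>x\<close> as soon as \<open>ord y\<close> divides \<open>ord x\<close>. Hence in a
  cyclic group adjacency in the power graph depends on the orders alone, and the enhanced power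
  graph is complete. Conversely, each of the two graph equalities makes elements of equal order
  powers of one another, so that there are at most \<open>\<phi> d\<close> elements of order \<open>d\<close>. As \<open>\<phi> d\<close> summed
  over the divisors \<open>d\<close> of \<open>n = |G|\<close> is \<open>n\<close>, no \<open>d\<close> can be missed, and there is an element of order \<open>n\<close>.
\<close>

context group
begin

text \<open>With \<open>m = ord c\<close>, the order of \<open>c [^] k\<close> is
  \<open>m div gcd m k\<close>. Divisibility of the orders therefore reverses into
  \<open>gcd m i dvd gcd m j\<close>, which is what makes \<open>i * k = j\<close> solvable modulo
  \<open>m\<close>.\<close>

lemma ord_pow_dvd_imp_power:
  assumes c: "c \<in> carrier G" and pos: "0 < ord c"
    and dvd: "ord (c [^] (j::nat)) dvd ord (c [^] (i::nat))"
  shows "\<exists>n::nat. 0 < n \<and> c [^] j = (c [^] i) [^] n"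
proof -
  let ?m = "ord c"
  have ord_eq: "ord (c [^] k) = ?m div gcd ?m k" for k :: nat
    using pos by (simp add: ord_pow_gen c)
  from dvd obtain q where "?m div gcd ?m i = ?m div gcd ?m j * q"
    by (auto simp: ord_eq)
  then have "gcd ?m i * (?m div gcd ?m j * q) = gcd ?m j * (?m div gcd ?m j)"
    by (metis dvd_mult_div_cancel gcd_dvd1)
  then have "(gcd ?m i * q) * (?m div gcd ?m j) = gcd ?m j * (?m div gcd ?m j)"
    by (simp only: ac_simps)
  moreover have "?m div gcd ?m j \<noteq> 0"
    using pos by (metis dvd_mult_div_cancel gcd_dvd1 less_irrefl mult_0_right)
  ultimately have "gcd ?m i * q = gcd ?m j"
    by (simp only: mult_cancel_right simp_thms)
  then have "gcd ?m i dvd gcd ?m j"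
    by (metis dvd_triv_left)
  then have "gcd i ?m dvd j"
    by (metis gcd.commute gcd_dvd2 dvd_trans)
  then obtain k where k: "[i * k = j] (mod ?m)"
    using cong_solve_dvd_nat by blast
  \<comment> \<open>The solution \<open>k\<close> may be 0; adding \<open>?m\<close> keeps the
    congruence and gives the positive exponent that the power graph requires.\<close>
  have "[i * (k + ?m) = j] (mod ?m)"
    using k by (simp add: cong_def algebra_simps)
  then have "[int (i * (k + ?m)) = int j] (mod int ?m)"
    by (simp only: cong_int_iff)
  then have "int ?m dvd int j - int (i * (k + ?m))"
    by (meson cong_iff_dvd_diff cong_sym)
  then have "c [^] int (i * (k + ?m)) = c [^] int j"
    using c by (simp only: int_pow_eq)
  then have "c [^] (i * (k + ?m)) = c [^] j"
    by (simp only: int_pow_int)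
  then show ?thesis
    using c pos by (intro exI[of _ "k + ?m"]) (simp add: nat_pow_pow)
qed

text \<open>Both elements are powers of one generator \<open>c\<close> of \<open>C\<close>. Since
  \<open>c\<close> has finite order, natural exponents suffice, and the previous lemma
  applies.\<close>

lemma cyclic_subgroup_ord_dvd_imp_power:
  assumes fin: "finite (carrier G)"
    and C: "subgroup C G" "cyclic_group (G\<lparr>carrier := C\<rparr>)"
    and mem: "x \<in> C" "y \<in> C" and dvd: "ord y dvd ord x"
  shows "\<exists>n::nat. 0 < n \<and> y = x [^] n"
proof -
  interpret C: group "G\<lparr>carrier := C\<rparr>"
    using C(1) by (rule subgroup.subgroup_is_group) (rule is_group)
  obtain c where c: "c \<in> C" and "C = range (\<lambda>n::int. c [^]\<^bsub>G\<lparr>carrier := C\<rparr>\<^esub> n)"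
    using C(2) unfolding C.cyclic_group by auto
  then have Cr: "C = range (\<lambda>n::int. c [^] n)"
    using int_pow_consistent[OF C(1) c] by simp
  have cG: "c \<in> carrier G"
    using c C(1) subgroup.subset by blast
  have "C = generate G {c}"
    unfolding Cr generate_pow[OF cG] by auto
  then have "C = {c [^] k | k. k \<in> (UNIV :: nat set)}"
    by (simp add: generate_pow_on_finite_carrier[OF fin cG])
  then obtain i j :: nat where "x = c [^] i" "y = c [^] j"
    using mem by blast
  moreover have "0 < ord c"
    using ord_ge_1[OF fin cG] by simp
  ultimately show ?thesis
    using ord_pow_dvd_imp_power[OF cG] dvd by blast
qed

lemma cyclic_subgroup_generate:
  assumes "x \<in> carrier G"
  shows "cyclic_group (G\<lparr>carrier := generate G {x}\<rparr>)"
  using cyclic_group_generated[of x] assms by (simp add: subgroup_generated_def)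

text \<open>The subgroup generated by \<open>x\<close> is cyclic and contains every power of
  \<open>x\<close>. Through this inclusion one converse argument serves both graphs.\<close>

lemma parcs_power_graph_subset: "parcs (power_graph G) \<subseteq> parcs (enhanced_power_graph G)"
proof -
  have "\<exists>C. subgroup C G \<and> cyclic_group (G\<lparr>carrier := C\<rparr>) \<and> x \<in> C \<and> x [^] n \<in> C"
    if x: "x \<in> carrier G" for x and n :: nat
  proof (intro exI conjI)
    show "subgroup (generate G {x}) G"
      using x by (intro generate_is_subgroup) auto
    show "x \<in> generate G {x}"
      by (simp add: generate.incl)
    then show "x [^] n \<in> generate G {x}"
      using generate_pow[OF x] by (force simp: int_pow_int[symmetric])
  qed (rule cyclic_subgroup_generate[OF x])
  then show ?thesis
    unfolding power_graph_def enhanced_power_graph_def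
    by (intro subsetI) (clarsimp, metis)
qed

text \<open>A power \<open>x [^] k\<close> has the order of \<open>x\<close> exactly when
  \<open>k\<close> is coprime to \<open>ord x\<close>, and \<open>phi'\<close> counts such
  \<open>k\<close> between 1 and \<open>ord x\<close>.\<close>

lemma card_ord_eq_le:
  assumes fin: "finite (carrier G)" and x: "x \<in> carrier G"
    and pow: "\<And>y. \<lbrakk>y \<in> carrier G; ord y = ord x\<rbrakk> \<Longrightarrow> \<exists>n::nat. 0 < n \<and> y = x [^] n"
  shows "card {y \<in> carrier G. ord y = ord x} \<le> phi' (ord x)"
proof -
  let ?K = "{k. 1 \<le> k \<and> k \<le> ord x \<and> coprime k (ord x)}"
  have pos: "ord x > 0"
    using ord_ge_1[OF fin x] by simp
  have "{y \<in> carrier G. ord y = ord x} \<subseteq> (\<lambda>k::nat. x [^] k) ` ?K"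
  proof
    fix y assume y: "y \<in> {y \<in> carrier G. ord y = ord x}"
    then have "y \<in> {x [^] k | k. k \<in> (UNIV :: nat set)}"
      using pow by auto
    also have "\<dots> = (\<lambda>k. x [^] k) ` {1 .. ord x}"
    proof (intro subset_antisym subsetI)
      fix z assume "z \<in> {x [^] k | k. k \<in> (UNIV :: nat set)}"
      then obtain k where k: "z = x [^] k" "k \<in> {0 .. ord x - 1}"
        unfolding ord_elems[OF fin x] by auto
      \<comment> \<open>\<open>ord_elems\<close> takes exponents from 0 to \<open>ord x - 1\<close>,
        but \<open>phi'\<close> counts from 1 to \<open>ord x\<close>; so 0 is traded for
        \<open>ord x\<close>, both giving the identity.\<close>
      have "z = x [^] (if k = 0 then ord x else k)"
        using k x by auto
      then show "z \<in> (\<lambda>k. x [^] k) ` {1 .. ord x}"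
        using k pos by (intro image_eqI[of _ _ "if k = 0 then ord x else k"]) auto
    qed auto
    finally obtain k where k: "y = x [^] k" "1 \<le> k" "k \<le> ord x"
      by auto
    moreover have "coprime k (ord x)"
      using y k pow_ord_eq_ord_iff[OF fin x, of k] by auto
    ultimately show "y \<in> (\<lambda>k. x [^] k) ` ?K"
      by auto
  qed
  then have "card {y \<in> carrier G. ord y = ord x} \<le> card ?K"
    by (intro surj_card_le) auto
  then show ?thesis
    by (simp add: phi'_def)
qed

lemma cyclic_if_equal_ord_powers:
  assumes fin: "finite (carrier G)"
    and pow: "\<And>x y. \<lbrakk>x \<in> carrier G; y \<in> carrier G; ord y = ord x\<rbrakk> \<Longrightarrow> \<exists>n::nat. 0 < n \<and> y = x [^] n"
  shows "cyclic_group G"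
proof -
  let ?N = "\<lambda>d. {x \<in> carrier G. ord x = d}"
  let ?D = "{d. d dvd order G}"
  have pos: "0 < order G"
    using fin by (simp add: order_gt_0_iff_finite)
  then have finD: "finite ?D"
    by simp
  have le: "card (?N d) \<le> phi' d" for d
  proof (cases "?N d = {}")
    case False
    then show ?thesis
      using card_ord_eq_le[OF fin] pow by fastforce
  qed (simp only: card.empty le0)
  have "carrier G = (\<Union>d\<in>?D. ?N d)"
    using ord_dvd_group_order by auto
  then have "order G = card (\<Union>d\<in>?D. ?N d)"
    by (simp add: order_def)
  also have "\<dots> = (\<Sum>d\<in>?D. card (?N d))"
    using finD fin by (intro card_UN_disjoint) auto
  finally have "(\<Sum>d\<in>?D. card (?N d)) = (\<Sum>d\<in>?D. phi' d)"
    using sum_phi'_factors[OF pos] by simp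
  \<comment> \<open>Equal sums with termwise inequality \<open>le\<close> force equality in every
    term, in particular at the divisor \<open>order G\<close>.\<close>
  then have "card (?N (order G)) = phi' (order G)"
    by (rule sum_mono_inv) (rule le, simp, rule finD)
  then have "card (?N (order G)) > 0"
    using phi'_nonzero[OF pos] by simp
  then obtain x where x: "x \<in> carrier G" "ord x = order G"
    by (auto simp: card_gt_0_iff)
  have "generate G {x} = carrier G"
  proof (rule card_subset_eq[OF fin])
    show "generate G {x} \<subseteq> carrier G"
      using x by (intro generate_incl) simp
    show "card (generate G {x}) = card (carrier G)"
      using x generate_pow_card[of x] by (simp add: order_def)
  qed
  then show ?thesis
    using cyclic_subgroup_generate[OF x(1)] by simp
qed

lemma parcs_subset_order_super_graph:
  assumes "parcs A \<subseteq> {(x, y). x \<in> carrier G \<and> y \<in> carrier G \<and> x \<noteq> y}"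
  shows "parcs A \<subseteq> parcs (order_super_graph G A)"
  using assms unfolding order_super_graph_def by auto

text \<open>Distinct elements of equal order are adjacent in the super graph, hence in
  \<open>A\<close>, hence lie in a common cyclic subgroup, where equal orders make each a power of
  the other.\<close>

lemma cyclic_if_eq_order_super_graph:
  assumes fin: "finite (carrier G)"
    and sub: "parcs A \<subseteq> parcs (enhanced_power_graph G)"
    and eq: "A = order_super_graph G A"
  shows "cyclic_group G"
proof (rule cyclic_if_equal_ord_powers[OF fin])
  fix x y assume xy: "x \<in> carrier G" "y \<in> carrier G" "ord y = ord x"
  show "\<exists>n::nat. 0 < n \<and> y = x [^] n"
  proof (cases "x = y")
    case True
    then show ?thesis
      using xy by (intro exI[of _ 1]) auto
  next
    case False
    then have "(x, y) \<in> parcs (order_super_graph G A)"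
      using xy by (simp add: order_super_graph_def)
    then have "(x, y) \<in> parcs (enhanced_power_graph G)"
      using eq sub by auto
    then show ?thesis
      using cyclic_subgroup_ord_dvd_imp_power[OF fin] xy
      by (auto simp: enhanced_power_graph_def)
  qed
qed

lemma cyclic_imp_power_graph_eq:
  assumes fin: "finite (carrier G)" and cyc: "cyclic_group G"
  shows "power_graph G = order_super_graph G (power_graph G)"
proof -
  have pow: "\<exists>n::nat. 0 < n \<and> y = x [^] n"
    if "x \<in> carrier G" "y \<in> carrier G" "ord y dvd ord x" for x y
    using cyclic_subgroup_ord_dvd_imp_power[OF fin subgroup_self] cyc that by simp
  have ord_dvd: "ord (x [^] n) dvd ord x" if "x \<in> carrier G" for x and n :: nat
    using that by (metis nat_pow_closed nat_pow_pow pow_eq_id dvd_triv_left mult.commute)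
  \<comment> \<open>Adjacency of distinct elements is now a condition on their orders, so it
    survives passing to other elements of the same orders; equal orders satisfy it too.\<close>
  have iff: "(x, y) \<in> parcs (power_graph G) \<longleftrightarrow>
      x \<in> carrier G \<and> y \<in> carrier G \<and> x \<noteq> y \<and> (ord y dvd ord x \<or> ord x dvd ord y)" for x y
    using pow ord_dvd unfolding power_graph_def by simp metis
  have "parcs (order_super_graph G (power_graph G)) \<subseteq> parcs (power_graph G)"
    unfolding order_super_graph_def by (auto simp: iff)
  moreover have "parcs (power_graph G) \<subseteq> parcs (order_super_graph G (power_graph G))"
    by (intro parcs_subset_order_super_graph) (auto simp: iff)
  ultimately have "parcs (power_graph G) = parcs (order_super_graph G (power_graph G))"
    by (rule subset_antisym[rotated])
  moreover have "pverts (power_graph G) = pverts (order_super_graph G (power_graph G))"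
    by (simp add: power_graph_def order_super_graph_def)
  ultimately show ?thesis
    by (intro pair_pre_digraph.equality) simp_all
qed

text \<open>The whole group is a common cyclic subgroup for any two elements, so the graph is
  complete and the super graph can add no edge.\<close>

lemma cyclic_imp_enhanced_power_graph_eq:
  assumes cyc: "cyclic_group G"
  shows "enhanced_power_graph G = order_super_graph G (enhanced_power_graph G)"
proof -
  have "parcs (enhanced_power_graph G) = {(x, y). x \<in> carrier G \<and> y \<in> carrier G \<and> x \<noteq> y}"
    using cyc subgroup_self unfolding enhanced_power_graph_def by (auto intro!: exI[of _ "carrier G"])
  moreover from this have "parcs (order_super_graph G (enhanced_power_graph G)) =
      {(x, y). x \<in> carrier G \<and> y \<in> carrier G \<and> x \<noteq> y}"
    unfolding order_super_graph_def by auto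
  ultimately show ?thesis
    by (simp add: enhanced_power_graph_def order_super_graph_def)
qed

end

theorem theorem3p1:
  fixes G :: "('a, 'b) monoid_scheme" (structure)
  assumes "group G" and "finite (carrier G)"
  shows "(power_graph G = order_super_graph G (power_graph G)
            \<longleftrightarrow> enhanced_power_graph G = order_super_graph G (enhanced_power_graph G)) \<and>
         (enhanced_power_graph G = order_super_graph G (enhanced_power_graph G)
            \<longleftrightarrow> cyclic_group G)"
proof -
  interpret group G by fact
  have "cyclic_group G" if "power_graph G = order_super_graph G (power_graph G)"
    using cyclic_if_eq_order_super_graph[OF assms(2) parcs_power_graph_subset that] .
  moreover have "cyclic_group G"
    if "enhanced_power_graph G = order_super_graph G (enhanced_power_graph G)"
    using cyclic_if_eq_order_super_graph[OF assms(2) subset_refl that] .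
  ultimately show ?thesis
    using cyclic_imp_power_graph_eq[OF assms(2)] cyclic_imp_enhanced_power_graph_eq by blast
qed

end
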